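(* Let $H$ be a space of real functions on $\mathbb R$ closed under shifts, equipped with the cylindrical $\sigma$-field, and let $T>0$. A mapping $L_T:H\times\mathbb R\to\mathbb R\cup\{\infty\}$ is a local intrinsic location functional with related length $T$ if and only if (1) $L_T(\cdot,a)$ is measurable for every $a\in\mathbb R$; and (2) for each $f\in H$ there exist a subset $S(f)\subseteq\mathbb R$ and a partial order $\preceq$ on it such that (a) for any $f\in H$ and $c\in\mathbb R$, $S(f)=S(\theta_cf)+c$; (b) for any $f\in H$, $c\in\mathbb R$ and $t_1,t_2\in S(f)$, $t_1\preceq t_2$ implies $t_1-c\preceq t_2-c$ in $S(\theta_cf)$; and such that for any $f\in H$ and $a\in\mathbb R$, either $S(f)\cap[a,a+T]=\emptyset$, in which case $L_T(f,a)=\infty$, or $L_T(f,a)$ is the maximal element of $S(f)\cap[a,a+T]$ according to $\preceq$.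
   Context: For $f\in H$, $c\in\mathbb R$: $\theta_cf(x)=f(x+c)$; closed under shifts means $\theta_cf\in H$. $\mathbb R\cup\{\infty\}$ carries the $\sigma$-field generated by the Borel sets of $\mathbb R$ and $\{\infty\}$; $\infty+c=\infty$. Local intrinsic location functional with related length $T$: a map $L_T:H\times\mathbb R\to\mathbb R\cup\{\infty\}$ such that (1) for every $a\in\mathbb R$, $L_T(\cdot,a):H\to\mathbb R\cup\{\infty\}$ is measurable; (2) $L_T(f,a)\in[a,a+T]\cup\{\infty\}$ for all $f\in H$, $a\in\mathbb R$; (3) $L_T(f,a)=L_T(\theta_cf,a-c)+c$ for all $f\in H$, $a,c\in\mathbb R$; (4) for all $f\in H$, $a,b\in\mathbb R$, $L_T(f,a)\in[b,b+T]$ implies that either $L_T(f,b)=L_T(f,a)$ or $L_T(f,b)\in[b,b+T]\setminus[a,a+T]$. "The maximal element" of $S(f)\cap[a,a+T]$ according to $\preceq$ means the element $m$ of this set with $s\preceq m$ for all $s\in S(f)\cap[a,a+T]$. *)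

theory Defs
  imports "HOL-Analysis.Analysis"
begin

definition shift :: "real \<Rightarrow> (real \<Rightarrow> real) \<Rightarrow> (real \<Rightarrow> real)" where
  "shift c f = (\<lambda>x. f (x + c))"

definition closed_under_shifts :: "(real \<Rightarrow> real) set \<Rightarrow> bool" where
  "closed_under_shifts H \<longleftrightarrow> (\<forall>f\<in>H. \<forall>c. shift c f \<in> H)"

definition cylindrical :: "(real \<Rightarrow> real) set \<Rightarrow> (real \<Rightarrow> real) measure" where
  "cylindrical H = sigma H {{f \<in> H. f t \<in> B} | t B. B \<in> sets (borel :: real measure)}"

text \<open>
  The set of real numbers with a single point at infinity adjoined is represented inside
  \<^typ>\<open>ereal\<close>, leaving out the value minus infinity; there \<open>\<infinity> + ereal c = \<infinity>\<close>.
\<close>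

definition real_infty :: "ereal set" where
  "real_infty = range ereal \<union> {\<infinity>}"

definition real_infty_algebra :: "ereal measure" where
  "real_infty_algebra =
     sigma real_infty ({ereal ` B | B. B \<in> sets (borel :: real measure)} \<union> {{\<infinity>}})"

definition local_intrinsic_location ::
    "(real \<Rightarrow> real) set \<Rightarrow> real \<Rightarrow> ((real \<Rightarrow> real) \<Rightarrow> real \<Rightarrow> ereal) \<Rightarrow> bool" where
  "local_intrinsic_location H T L \<longleftrightarrow>
     (\<forall>a. (\<lambda>f. L f a) \<in> measurable (cylindrical H) real_infty_algebra) \<and>
     (\<forall>f\<in>H. \<forall>a. L f a \<in> ereal ` {a..a + T} \<union> {\<infinity>}) \<and>
     (\<forall>f\<in>H. \<forall>a c. L f a = L (shift c f) (a - c) + ereal c) \<and>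
     (\<forall>f\<in>H. \<forall>a b. L f a \<in> ereal ` {b..b + T} \<longrightarrow>
        L f b = L f a \<or> L f b \<in> ereal ` {b..b + T} - ereal ` {a..a + T})"

text \<open>
  The order \<open>r\<close> relates \<open>s\<close> to \<open>m\<close> when \<open>s\<close> precedes or equals \<open>m\<close>. A maximal element is
  required to dominate every element of \<open>A\<close>, i.e. to be a greatest element.
\<close>

definition maximal_element :: "real rel \<Rightarrow> real set \<Rightarrow> real \<Rightarrow> bool" where
  "maximal_element r A m \<longleftrightarrow> m \<in> A \<and> (\<forall>s\<in>A. (s, m) \<in> r)"

end

theory Submission
  imports Defs
begin

text \<open>
  For the forward direction let \<open>S f\<close> be the set of finite values of \<open>L f\<close> and draw an arrow from
  \<open>s\<close> to \<open>t\<close> whenever some window \<open>[a, a + T]\<close> contains the value \<open>s\<close> while \<open>L f a = t\<close>. The order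
  is the reflexive transitive closure of the arrows, and the point is that the arrows have no cycle.
  If \<open>p \<rightarrow> M \<rightarrow> q\<close> with \<open>p, q < M\<close>, then condition (4) forces \<open>q < p\<close>, and the window witnessing
  \<open>M \<rightarrow> q\<close> also contains \<open>p\<close>, so \<open>p \<rightarrow> q\<close>. Hence the largest vertex of a cycle can always be
  bypassed, until nothing is left of the cycle.
\<close>

section \<open>Acyclicity of relations on a linear order\<close>

lemma trancl_imp_finite_restriction:
  assumes "(x, y) \<in> R\<^sup>+"
  shows "\<exists>A. finite A \<and> (x, y) \<in> (R \<inter> A \<times> A)\<^sup>+"
  using assms
proof (induction rule: trancl_induct)
  case (base y)
  then have "(x, y) \<in> (R \<inter> {x, y} \<times> {x, y})\<^sup>+" by blast
  then show ?case by (intro exI[of _ "{x, y}"]) simp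
next
  case (step y z)
  then obtain A where A: "finite A" "(x, y) \<in> (R \<inter> A \<times> A)\<^sup>+" by blast
  let ?B = "insert y (insert z A)"
  have "(x, y) \<in> (R \<inter> ?B \<times> ?B)\<^sup>+"
    by (rule trancl_mono[OF A(2)]) blast
  moreover have "(y, z) \<in> R \<inter> ?B \<times> ?B" using step.hyps by blast
  ultimately have "(x, z) \<in> (R \<inter> ?B \<times> ?B)\<^sup>+" by (rule trancl_into_trancl)
  moreover have "finite ?B" using A(1) by simp
  ultimately show ?case by (intro exI[of _ ?B] conjI)
qed

text \<open>On a finite vertex set, build the set in increasing order. By \<open>irr\<close> both
  neighbours of a new largest vertex \<open>M\<close> on a cycle are smaller, so \<open>peak\<close>
  short-cuts every visit to \<open>M\<close>.\<close>

lemma acyclic_if_peaks_bypassed: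
  fixes R :: "('a :: linorder) rel"
  assumes irr: "irrefl R"
    and peak: "\<And>p M q. (p, M) \<in> R \<Longrightarrow> (M, q) \<in> R \<Longrightarrow> p < M \<Longrightarrow> q < M \<Longrightarrow> (p, q) \<in> R"
  shows "acyclic R"
proof -
  have fin: "acyclic (R \<inter> A \<times> A)" if "finite A" for A
    using that
  proof (induction A rule: finite_linorder_max_induct)
    case empty
    show ?case by (simp add: acyclic_def)
  next
    case (insert M A)
    let ?B = "insert M A" and ?R' = "R \<inter> A \<times> A"
    \<comment> \<open>Invariant for a walk from \<open>x\<close>: all completed visits to
      \<open>M\<close> have been bypassed. A walk currently at \<open>M\<close> keeps its
      predecessor \<open>p\<close>, since the bypass needs the next vertex; \<open>p\<close> may be
      \<open>x\<close> itself, hence the reflexive closure.\<close>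
    have walk: "if y = M then \<exists>p\<in>A. (x, p) \<in> ?R'\<^sup>* \<and> (p, M) \<in> R else (x, y) \<in> ?R'\<^sup>+"
      if "(x, y) \<in> (R \<inter> ?B \<times> ?B)\<^sup>+" "x \<in> A" for x y
      using that(1)
    proof (induction rule: trancl_induct)
      case (base y)
      then show ?case using \<open>x \<in> A\<close> by auto
    next
      case (step y z)
      have yz: "(y, z) \<in> R" "y \<in> ?B" "z \<in> ?B" using step.hyps by auto
      show ?case
      proof (cases "y = M")
        case True
        with step.IH obtain p where p: "p \<in> A" "(x, p) \<in> ?R'\<^sup>*" "(p, M) \<in> R" by auto
        have "z \<noteq> M" using yz(1) True irr by (auto simp: irrefl_def)
        with yz have "z \<in> A" by simp
        then have "(p, z) \<in> ?R'"
          using peak[OF p(3), of z] yz(1) True insert.hyps p(1) by auto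
        with p(2) have "(x, z) \<in> ?R'\<^sup>+" by (rule rtrancl_into_trancl1)
        with \<open>z \<noteq> M\<close> show ?thesis by simp
      next
        case False
        with step.IH have xy: "(x, y) \<in> ?R'\<^sup>+" by simp
        have "y \<in> A" using False yz by simp
        show ?thesis
        proof (cases "z = M")
          case True
          with xy \<open>y \<in> A\<close> yz show ?thesis by (auto intro: trancl_into_rtrancl)
        next
          case False
          with yz \<open>y \<in> A\<close> have "(y, z) \<in> ?R'" by simp
          with xy False show ?thesis by (auto intro: trancl_into_trancl)
        qed
      qed
    qed
    have "(x, x) \<notin> (R \<inter> ?B \<times> ?B)\<^sup>+" for x
    proof
      assume x: "(x, x) \<in> (R \<inter> ?B \<times> ?B)\<^sup>+"
      have "x \<in> ?B" using tranclD[OF x] by auto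
      show False
      proof (cases "x = M")
        case False
        with \<open>x \<in> ?B\<close> walk[OF x] insert.IH show False by (auto simp: acyclic_def)
      next
        case True
        \<comment> \<open>A cycle based at \<open>M\<close> is rotated to start at the successor
          \<open>q\<close> of \<open>M\<close>, so that \<open>walk\<close> applies.\<close>
        with x obtain q where q: "(M, q) \<in> R" "q \<in> ?B" "(q, M) \<in> (R \<inter> ?B \<times> ?B)\<^sup>*"
          by (auto dest: tranclD)
        have "q \<noteq> M" using q(1) irr by (auto simp: irrefl_def)
        with q have "q \<in> A" "(q, M) \<in> (R \<inter> ?B \<times> ?B)\<^sup>+"
          by (auto simp: rtrancl_eq_or_trancl)
        with walk obtain p where p: "p \<in> A" "(q, p) \<in> ?R'\<^sup>*" "(p, M) \<in> R" by fastforce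
        have "(p, q) \<in> ?R'"
          using peak[OF p(3) q(1)] insert.hyps p(1) \<open>q \<in> A\<close> by auto
        with p(2) have "(q, q) \<in> ?R'\<^sup>+" by (rule rtrancl_into_trancl1)
        with insert.IH show False by (auto simp: acyclic_def)
      qed
    qed
    then show ?case by (simp add: acyclic_def)
  qed
  \<comment> \<open>A cycle uses finitely many arrows, so it already lies in a finite
    restriction.\<close>
  show ?thesis
    unfolding acyclic_def using trancl_imp_finite_restriction fin by (metis acyclic_def)
qed

section \<open>The order generated by the arrows\<close>

definition finite_values :: "(real \<Rightarrow> ereal) \<Rightarrow> real set" where
  "finite_values l = {s. \<exists>a. l a = ereal s}"

text \<open>A value lies in its own window, so \<open>s \<noteq> t\<close> is what keeps loops
  out.\<close>

definition arrows :: "real \<Rightarrow> (real \<Rightarrow> ereal) \<Rightarrow> real rel" where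
  "arrows T l =
     {(s, t). s \<noteq> t \<and> s \<in> finite_values l \<and> (\<exists>a. l a = ereal t \<and> s \<in> {a..a + T})}"

text \<open>The identity is restricted to \<open>finite_values l\<close>, because
  \<open>(arrows T l)\<^sup>*\<close> would relate every real to itself and leave the
  carrier.\<close>

definition arrow_order :: "real \<Rightarrow> (real \<Rightarrow> ereal) \<Rightarrow> real rel" where
  "arrow_order T l = Id_on (finite_values l) \<union> (arrows T l)\<^sup>+"

lemma arrows_subset: "arrows T l \<subseteq> finite_values l \<times> finite_values l"
  by (auto simp: arrows_def finite_values_def)

lemma partial_order_on_arrow_order:
  assumes "acyclic (arrows T l)"
  shows "partial_order_on (finite_values l) (arrow_order T l)"
proof -
  have sub: "(arrows T l)\<^sup>+ \<subseteq> finite_values l \<times> finite_values l"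
    by (rule trancl_subset_Sigma[OF arrows_subset])
  have "trans (arrow_order T l)"
    unfolding arrow_order_def
    by (rule transI) (elim UnE Id_onE; blast dest: trancl_trans)
  moreover have "antisym (arrow_order T l)"
    using assms unfolding arrow_order_def acyclic_def
    by (intro antisymI) (elim UnE Id_onE; blast dest: trancl_trans)
  moreover have "refl_on (finite_values l) (arrow_order T l)"
    using sub by (auto simp: arrow_order_def refl_on_def)
  ultimately show ?thesis
    using sub by (auto simp: partial_order_on_def preorder_on_def arrow_order_def)
qed

section \<open>Translation of values, arrows and order\<close>

lemma finite_values_translate:
  assumes "\<And>a. l a = l' (a - c) + ereal c"
  shows "finite_values l = (\<lambda>x. x + c) ` finite_values l'"
proof (intro set_eqI iffI)
  fix s assume "s \<in> finite_values l"
  then obtain a where "l a = ereal s" by (auto simp: finite_values_def)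
  then have "l' (a - c) = ereal (s - c)"
    using assms[of a] by (cases "l' (a - c)") auto
  then have "s - c \<in> finite_values l'" by (auto simp: finite_values_def)
  then show "s \<in> (\<lambda>x. x + c) ` finite_values l'" by (intro image_eqI[of _ _ "s - c"]) auto
next
  fix s assume "s \<in> (\<lambda>x. x + c) ` finite_values l'"
  then obtain a x where "l' a = ereal x" "s = x + c" by (auto simp: finite_values_def)
  then have "l (a + c) = ereal s" using assms[of "a + c"] by simp
  then show "s \<in> finite_values l" by (auto simp: finite_values_def)
qed

lemma arrows_translate:
  assumes l: "\<And>a. l a = l' (a - c) + ereal c"
    and st: "(s, t) \<in> arrows T l"
  shows "(s - c, t - c) \<in> arrows T l'"
proof -
  from st obtain a where a: "s \<noteq> t" "s \<in> finite_values l" "l a = ereal t" "s \<in> {a..a + T}"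
    by (auto simp: arrows_def)
  have "l' (a - c) = ereal (t - c)"
    using l[of a] a(3) by (cases "l' (a - c)") auto
  moreover have "s - c \<in> finite_values l'"
    using a(2) finite_values_translate[of l l' c, OF l] by auto
  moreover have "s - c \<in> {a - c..a - c + T}" using a(4) by auto
  ultimately show ?thesis using a(1) by (auto simp: arrows_def)
qed

text \<open>Translation by \<open>- c\<close> maps arrows to arrows, hence paths to paths. In the
  application \<open>l\<close> is \<open>L f\<close>, \<open>l'\<close> is
  \<open>L (shift c f)\<close>, and the first hypothesis is condition (3).\<close>

lemma arrow_order_translate:
  assumes l: "\<And>a. l a = l' (a - c) + ereal c"
    and st: "(s, t) \<in> arrow_order T l"
  shows "(s - c, t - c) \<in> arrow_order T l'"
proof -
  have "(s - c, t - c) \<in> (arrows T l')\<^sup>+" if "(s, t) \<in> (arrows T l)\<^sup>+"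
    using that
    by (induction rule: trancl_induct) (auto intro: arrows_translate[of l l' c, OF l] trancl_into_trancl)
  moreover have "s - c \<in> finite_values l'" if "s \<in> finite_values l"
    using that finite_values_translate[of l l' c, OF l] by auto
  ultimately show ?thesis using st by (auto simp: arrow_order_def)
qed

lemma maximal_element_unique:
  assumes "antisym r" "maximal_element r A m" "maximal_element r A m'"
  shows "m = m'"
  using assms by (auto simp: maximal_element_def dest: antisymD)

text \<open>Each point of \<open>S'\<close> in the shifted window comes from a point of
  \<open>S\<close> in the original one, which \<open>m\<close> dominates; \<open>r\<close> carries
  this domination over to \<open>r'\<close>.\<close>

lemma maximal_element_translate:
  assumes S: "S = (\<lambda>x. x + c) ` S'"
    and r: "\<And>s t. s \<in> S \<Longrightarrow> t \<in> S \<Longrightarrow> (s, t) \<in> r \<Longrightarrow> (s - c, t - c) \<in> r'"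
    and m: "maximal_element r (S \<inter> {a..a + T}) m"
  shows "maximal_element r' (S' \<inter> {a - c..a - c + T}) (m - c)"
proof -
  have "(x, m - c) \<in> r'" if "x \<in> S'" "a - c \<le> x" "x \<le> a - c + T" for x
  proof -
    have "x + c \<in> S \<inter> {a..a + T}" using that S by auto
    then show ?thesis using r[of "x + c" m] m by (auto simp: maximal_element_def)
  qed
  moreover have "m - c \<in> S'" using m S by (auto simp: maximal_element_def)
  ultimately show ?thesis using m by (auto simp: maximal_element_def)
qed

section \<open>Values along one fixed function, under conditions (2) and (4)\<close>

context
  fixes T :: real and l :: "real \<Rightarrow> ereal"
  assumes window: "\<And>a. l a \<in> ereal ` {a..a + T} \<union> {\<infinity>}"
    and consistent: "\<And>a b. l a \<in> ereal ` {b..b + T} \<Longrightarrow>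
        l b = l a \<or> l b \<in> ereal ` {b..b + T} - ereal ` {a..a + T}"
begin

lemma value_in_window:
  assumes "l a = ereal t"
  shows "a \<le> t" "t \<le> a + T"
  using window[of a] assms by auto

text \<open>The second alternative of condition (4) would put \<open>u\<close> outside
  \<open>{a..a + T}\<close>.\<close>

lemma values_in_common_windows_eq:
  assumes "l a = ereal t" "l b = ereal u" "t \<in> {b..b + T}" "u \<in> {a..a + T}"
  shows "t = u"
  using consistent[of a b] assms by auto

lemma acyclic_arrows: "acyclic (arrows T l)"
proof (rule acyclic_if_peaks_bypassed)
  show "irrefl (arrows T l)" by (auto simp: irrefl_def arrows_def)
next
  fix p M q
  assume pM: "(p, M) \<in> arrows T l" and Mq: "(M, q) \<in> arrows T l" and less: "p < M" "q < M"
  from pM obtain a where p: "p \<in> finite_values l" and a: "l a = ereal M" "p \<in> {a..a + T}"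
    by (auto simp: arrows_def)
  from Mq obtain b where b: "l b = ereal q" "M \<in> {b..b + T}"
    by (auto simp: arrows_def)
  have "q < p"
  proof (rule ccontr)
    assume "\<not> q < p"
    \<comment> \<open>From \<open>p \<le> q < M\<close> with both ends in the window at
      \<open>a\<close>; then \<open>M\<close> and \<open>q\<close> lie in both windows and must
      coincide.\<close>
    then have "q \<in> {a..a + T}" using a(2) value_in_window[OF a(1)] less by auto
    then show False using values_in_common_windows_eq[OF a(1) b(1) b(2)] less by simp
  qed
  moreover from this have "p \<in> {b..b + T}" using b(2) value_in_window[OF b(1)] less by auto
  ultimately show "(p, q) \<in> arrows T l" using p b(1) by (auto simp: arrows_def)
qed

text \<open>If a value lies in the window at \<open>a\<close>, both alternatives of condition (4)
  make \<open>l a\<close> finite. If \<open>l a\<close> is finite, every other value in the window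
  has an arrow to it by definition.\<close>

lemma maximal_element_arrow_order:
  "(finite_values l \<inter> {a..a + T} = {} \<and> l a = \<infinity>) \<or>
   (\<exists>m. maximal_element (arrow_order T l) (finite_values l \<inter> {a..a + T}) m \<and> l a = ereal m)"
proof (cases "l a = \<infinity>")
  case True
  have False if "s \<in> finite_values l" "s \<in> {a..a + T}" for s
  proof -
    from that(1) obtain b where "l b = ereal s" by (auto simp: finite_values_def)
    with consistent[of b a] that(2) True show False by auto
  qed
  with True show ?thesis by blast
next
  case False
  then obtain m where m: "l a = ereal m" "m \<in> {a..a + T}" using window[of a] by auto
  then have "m \<in> finite_values l" by (auto simp: finite_values_def)
  moreover have "(s, m) \<in> arrow_order T l" if "s \<in> finite_values l" "s \<in> {a..a + T}" for s
    using that m(1) by (cases "s = m") (auto simp: arrow_order_def arrows_def)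
  ultimately show ?thesis using m by (auto simp: maximal_element_def)
qed

end

section \<open>Equivalence of the axioms with shift-compatible orders\<close>

theorem theorem3p4:
  fixes H :: "(real \<Rightarrow> real) set"
    and T :: real
    and L :: "(real \<Rightarrow> real) \<Rightarrow> real \<Rightarrow> ereal"
  assumes "closed_under_shifts H"
    and "T > 0"
    and "\<forall>f\<in>H. \<forall>a. L f a \<in> real_infty"
  shows "local_intrinsic_location H T L \<longleftrightarrow>
    (\<forall>a. (\<lambda>f. L f a) \<in> measurable (cylindrical H) real_infty_algebra) \<and>
    (\<exists>(S :: (real \<Rightarrow> real) \<Rightarrow> real set) (r :: (real \<Rightarrow> real) \<Rightarrow> real rel).
       (\<forall>f\<in>H. partial_order_on (S f) (r f)) \<and>
       (\<forall>f\<in>H. \<forall>c. S f = (\<lambda>x. x + c) ` S (shift c f)) \<and>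
       (\<forall>f\<in>H. \<forall>c. \<forall>t1\<in>S f. \<forall>t2\<in>S f.
          (t1, t2) \<in> r f \<longrightarrow> (t1 - c, t2 - c) \<in> r (shift c f)) \<and>
       (\<forall>f\<in>H. \<forall>a.
          (S f \<inter> {a..a + T} = {} \<and> L f a = \<infinity>) \<or>
          (\<exists>m. maximal_element (r f) (S f \<inter> {a..a + T}) m \<and> L f a = ereal m)))"
proof (intro iffI conjI)
  let "_ \<longleftrightarrow> ?M \<and> ?E" = ?thesis
  assume "local_intrinsic_location H T L"
  then have meas: ?M
    and window: "\<And>f a. f \<in> H \<Longrightarrow> L f a \<in> ereal ` {a..a + T} \<union> {\<infinity>}"
    and stationary: "\<And>f a c. f \<in> H \<Longrightarrow> L f a = L (shift c f) (a - c) + ereal c"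
    and consistent: "\<And>f a b. f \<in> H \<Longrightarrow> L f a \<in> ereal ` {b..b + T} \<Longrightarrow>
        L f b = L f a \<or> L f b \<in> ereal ` {b..b + T} - ereal ` {a..a + T}"
    unfolding local_intrinsic_location_def by blast+
  show ?M by (rule meas)
  \<comment> \<open>Both depend on \<open>f\<close> only through \<open>L f\<close>, so
    compatibility with shifts comes down to condition (3).\<close>
  let ?S = "\<lambda>f. finite_values (L f)" and ?r = "\<lambda>f. arrow_order T (L f)"
  show ?E
  proof (rule exI[of _ ?S], rule exI[of _ ?r], intro conjI ballI allI impI)
    fix f assume f: "f \<in> H"
    show "partial_order_on (?S f) (?r f)"
      by (rule partial_order_on_arrow_order[OF acyclic_arrows[OF window[OF f] consistent[OF f]]])
    show "?S f = (\<lambda>x. x + c) ` ?S (shift c f)" for c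
      by (rule finite_values_translate, rule stationary[OF f])
    show "(t1 - c, t2 - c) \<in> ?r (shift c f)" if "(t1, t2) \<in> ?r f" for c t1 t2
      by (rule arrow_order_translate[OF _ that], rule stationary[OF f])
    show "(?S f \<inter> {a..a + T} = {} \<and> L f a = \<infinity>) \<or>
          (\<exists>m. maximal_element (?r f) (?S f \<inter> {a..a + T}) m \<and> L f a = ereal m)" for a
      by (rule maximal_element_arrow_order[OF window[OF f] consistent[OF f]])
  qed
next
  let "_ \<longleftrightarrow> ?M \<and> ?E" = ?thesis
  assume rhs: "?M \<and> ?E"
  then have meas: ?M by (rule conjunct1)
  from rhs obtain S :: "(real \<Rightarrow> real) \<Rightarrow> real set" and r :: "(real \<Rightarrow> real) \<Rightarrow> real rel" where
    po: "\<forall>f\<in>H. partial_order_on (S f) (r f)"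
    and S_shift: "\<forall>f\<in>H. \<forall>c. S f = (\<lambda>x. x + c) ` S (shift c f)"
    and r_shift: "\<forall>f\<in>H. \<forall>c. \<forall>t1\<in>S f. \<forall>t2\<in>S f.
        (t1, t2) \<in> r f \<longrightarrow> (t1 - c, t2 - c) \<in> r (shift c f)"
    and L: "\<forall>f\<in>H. \<forall>a. (S f \<inter> {a..a + T} = {} \<and> L f a = \<infinity>) \<or>
          (\<exists>m. maximal_element (r f) (S f \<inter> {a..a + T}) m \<and> L f a = ereal m)"
    by (elim conjE exE) (rule that)
  note po = po[rule_format] and S_shift = S_shift[rule_format]
    and r_shift = r_shift[rule_format] and L = L[rule_format]
  have antisym: "antisym (r f)" if "f \<in> H" for f
    using po[OF that] by (simp add: partial_order_on_def)
  have window: "L f a \<in> ereal ` {a..a + T} \<union> {\<infinity>}" if "f \<in> H" for f a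
    using L[OF that, of a] by (auto simp: maximal_element_def)
  have stationary: "L f a = L (shift c f) (a - c) + ereal c" if f: "f \<in> H" for f a c
  proof -
    have g: "shift c f \<in> H" using assms(1) f by (auto simp: closed_under_shifts_def)
    consider "S f \<inter> {a..a + T} = {}" "L f a = \<infinity>"
      | m where "maximal_element (r f) (S f \<inter> {a..a + T}) m" "L f a = ereal m"
      using L[OF f, of a] by blast
    then show ?thesis
    proof cases
      case 1
      \<comment> \<open>A point in the shifted window would translate back into the empty
        one.\<close>
      have False if "x \<in> S (shift c f) \<inter> {a - c..a - c + T}" for x
      proof -
        have "x + c \<in> S f \<inter> {a..a + T}" using that S_shift[OF f, of c] by auto
        with 1 show False by blast
      qed
      then have "L (shift c f) (a - c) = \<infinity>"
        using L[OF g, of "a - c"] by (auto simp only: maximal_element_def)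
      with 1 show ?thesis by simp
    next
      case 2
      have m: "maximal_element (r (shift c f)) (S (shift c f) \<inter> {a - c..a - c + T}) (m - c)"
        by (rule maximal_element_translate[OF S_shift[OF f] r_shift[OF f] 2(1)])
      \<comment> \<open>This excludes the value \<open>\<infinity>\<close>; antisymmetry then
        identifies the finite value with \<open>m - c\<close>.\<close>
      then have "S (shift c f) \<inter> {a - c..a - c + T} \<noteq> {}"
        unfolding maximal_element_def by blast
      with L[OF g, of "a - c"] obtain m' where
        "maximal_element (r (shift c f)) (S (shift c f) \<inter> {a - c..a - c + T}) m'"
        and m': "L (shift c f) (a - c) = ereal m'" by blast
      then have "m' = m - c" using maximal_element_unique[OF antisym[OF g] _ m] by blast
      with 2 m' show ?thesis by simp
    qed
  qed
  have consistent: "L f b = L f a \<or> L f b \<in> ereal ` {b..b + T} - ereal ` {a..a + T}"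
    if f: "f \<in> H" and ab: "L f a \<in> ereal ` {b..b + T}" for f a b
  proof -
    from ab L[OF f, of a] obtain m where
      m: "maximal_element (r f) (S f \<inter> {a..a + T}) m" "L f a = ereal m" by auto
    \<comment> \<open>So the window at \<open>b\<close> meets \<open>S f\<close>, and
      \<open>L f b\<close> is finite.\<close>
    with ab have mb: "m \<in> S f \<inter> {b..b + T}" by (auto simp: maximal_element_def)
    with L[OF f, of b] obtain m' where
      m': "maximal_element (r f) (S f \<inter> {b..b + T}) m'" "L f b = ereal m'" by blast
    \<comment> \<open>Here \<open>m\<close> and \<open>m'\<close> lie in both windows and dominate
      each other. If instead \<open>m'\<close> misses the window at \<open>a\<close>, the second
      alternative of condition (4) holds.\<close>
    have "m' = m" if "m' \<in> {a..a + T}"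
      using that m m' mb antisymD[OF antisym[OF f], of m m']
      by (auto simp: maximal_element_def)
    then show ?thesis using m m' by (auto simp: maximal_element_def)
  qed
  show "local_intrinsic_location H T L"
    unfolding local_intrinsic_location_def
    by (intro conjI meas ballI allI impI; rule window stationary consistent; assumption)
qed

end
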